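(* The two-dimensional subalgebras of ${\rm S}_2$ are exactly $\langle e_1,e_2\rangle$, $\langle e_1\pm e_3,e_2\rangle$ and $\langle e_1,\alpha e_2+e_3\rangle$ ($\alpha\in\mathbb{C}$). Up to automorphisms of ${\rm S}_2$, every two-dimensional subalgebra is equivalent to one of $\langle e_1,e_2\rangle$, $\langle e_1+e_3,e_2\rangle$, $\langle e_1-e_3,e_2\rangle$, $\langle e_1,e_3\rangle$.
   Context: ${\rm S}_2$ is the complex algebra with basis $e_1,e_2,e_3$, unit $e_1$ ($e_1e_i=e_ie_1=e_i$), $e_2e_3=e_2$, $e_3e_2=-e_2$, $e_3e_3=e_1$; all other products of basis elements are zero. A subalgebra is a linear subspace closed under multiplication (it need not contain $e_1$). Equivalence up to automorphisms means one is mapped onto the other by an algebra automorphism. $\langle S\rangle$ denotes linear span. *)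

theory Defs
  imports "HOL-Analysis.Analysis"
begin

text \<open>The algebra S_2: underlying space complex^3, coordinates 1,2,3 w.r.t. basis e1,e2,e3.
 Multiplication is the bilinear extension of the table on basis elements.\<close>

definition s2e1 :: "complex ^ 3" where "s2e1 = (\<chi> i. if i = 1 then 1 else 0)"
definition s2e2 :: "complex ^ 3" where "s2e2 = (\<chi> i. if i = 2 then 1 else 0)"
definition s2e3 :: "complex ^ 3" where "s2e3 = (\<chi> i. if i = 3 then 1 else 0)"

definition s2mult :: "complex ^ 3 \<Rightarrow> complex ^ 3 \<Rightarrow> complex ^ 3" where
  "s2mult x y = (\<chi> i.
     if i = 1 then x$1 * y$1 + x$3 * y$3
     else if i = 2 then x$1 * y$2 + x$2 * y$1 + x$2 * y$3 - x$3 * y$2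
     else x$1 * y$3 + x$3 * y$1)"

definition s2_subalgebra :: "(complex ^ 3) set \<Rightarrow> bool" where
  "s2_subalgebra A \<longleftrightarrow> vec.subspace A \<and> (\<forall>x\<in>A. \<forall>y\<in>A. s2mult x y \<in> A)"

definition s2_automorphism :: "(complex ^ 3 \<Rightarrow> complex ^ 3) \<Rightarrow> bool" where
  "s2_automorphism f \<longleftrightarrow> Vector_Spaces.linear (*s) (*s) f \<and> bij f \<and>
     (\<forall>x y. f (s2mult x y) = s2mult (f x) (f y))"

end

theory Submission
  imports Defs
begin

text \<open>The line \<open>\<langle>e\<^sub>2\<rangle>\<close> is a two-sided ideal, and projecting along it
  identifies \<open>S\<^sub>2/\<langle>e\<^sub>2\<rangle>\<close> with the subalgebra \<open>\<langle>e\<^sub>1, e\<^sub>3\<rangle> \<cong> \<complex> \<times> \<complex>\<close>,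
  whose nonzero idempotents are \<open>e\<^sub>1\<close> and \<open>(e\<^sub>1 \<plusminus> e\<^sub>3)/2\<close>.
  If a two-dimensional subalgebra \<open>A\<close> misses \<open>e\<^sub>2\<close>, the projection maps \<open>A\<close> bijectively
  onto \<open>\<langle>e\<^sub>1, e\<^sub>3\<rangle>\<close>; the preimage of \<open>e\<^sub>1\<close> is then idempotent, which forces it to
  be \<open>e\<^sub>1\<close>, and \<open>A = \<langle>e\<^sub>1, \<alpha>e\<^sub>2 + e\<^sub>3\<rangle>\<close>. If \<open>e\<^sub>2 \<in> A\<close>, then
  \<open>A = \<langle>x, e\<^sub>2\<rangle>\<close> with \<open>x \<in> \<langle>e\<^sub>1, e\<^sub>3\<rangle>\<close>, and closure gives \<open>x\<^sup>2 \<in> \<complex>x\<close>, so \<open>x\<close>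
  is a multiple of an idempotent. Finally the shear \<open>e\<^sub>3 \<mapsto> e\<^sub>3 - \<alpha>e\<^sub>2\<close> is an
  automorphism carrying \<open>\<langle>e\<^sub>1, \<alpha>e\<^sub>2 + e\<^sub>3\<rangle>\<close> to \<open>\<langle>e\<^sub>1, e\<^sub>3\<rangle>\<close>.\<close>

lemma vec3_eq_iff: "(x::'a^3) = y \<longleftrightarrow> x$1 = y$1 \<and> x$2 = y$2 \<and> x$3 = y$3"
  by (simp add: vec_eq_iff forall_3)

lemma mem_span_pair_iff: "x \<in> vec.span {u, v} \<longleftrightarrow> (\<exists>a b. x = a *s u + b *s v)"
  by (simp add: vec.span_breakdown_eq vec.span_singleton image_iff diff_eq_eq add.commute)

lemma dim_pair:
  fixes u v :: "'a::field ^ 'n"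
  assumes "u \<noteq> 0" and "v \<notin> vec.span {u}"
  shows "vec.dim {u, v} = 2"
proof -
  have "u \<noteq> v" using assms(2) vec.span_base by blast
  moreover have "vec.independent {v, u}"
    using assms by (simp add: vec.independent_insert)
  ultimately show ?thesis
    by (simp add: vec.dim_eq_card_independent insert_commute)
qed

lemma subspace_eq_span_pair:
  fixes u v :: "'a::field ^ 'n"
  assumes "vec.subspace A" and "vec.dim A = 2" and "u \<in> A" and "v \<in> A"
    and "u \<noteq> 0" and "v \<notin> vec.span {u}"
  shows "A = vec.span {u, v}"
proof (rule sym, rule vec.subspace_dim_equal)
  show "vec.span {u, v} \<subseteq> A"
    using assms(1,3,4) by (simp add: vec.span_minimal)
  show "vec.dim A \<le> vec.dim (vec.span {u, v})"
    using assms(2,5,6) by (simp add: dim_pair)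
qed (use assms(1) in simp_all)

lemma s2e_nth [simp]:
  "s2e1$1 = 1" "s2e1$2 = 0" "s2e1$3 = 0"
  "s2e2$1 = 0" "s2e2$2 = 1" "s2e2$3 = 0"
  "s2e3$1 = 0" "s2e3$2 = 0" "s2e3$3 = 1"
  by (simp_all add: s2e1_def s2e2_def s2e3_def)

lemma s2mult_nth [simp]:
  "s2mult x y $ 1 = x$1 * y$1 + x$3 * y$3"
  "s2mult x y $ 2 = x$1 * y$2 + x$2 * y$1 + x$2 * y$3 - x$3 * y$2"
  "s2mult x y $ 3 = x$1 * y$3 + x$3 * y$1"
  by (simp_all add: s2mult_def)

lemma s2e2_notin_span_singleton: "x$2 = 0 \<Longrightarrow> s2e2 \<notin> vec.span {x}"
  by (auto simp: vec.span_singleton vec3_eq_iff)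

definition s2_proj :: "complex^3 \<Rightarrow> complex^3" where
  "s2_proj x = x - x$2 *s s2e2"

lemma s2_proj_nth [simp]: "s2_proj x $ 1 = x$1" "s2_proj x $ 2 = 0" "s2_proj x $ 3 = x$3"
  by (simp_all add: s2_proj_def)

lemma linear_s2_proj: "Vector_Spaces.linear (*s) (*s) s2_proj"
  by unfold_locales (simp_all add: vec3_eq_iff algebra_simps)

lemma s2_proj_s2mult: "s2_proj (s2mult x y) = s2mult (s2_proj x) (s2_proj y)"
  by (simp add: vec3_eq_iff)

lemma inj_on_s2_proj:
  assumes "vec.subspace A" and "s2e2 \<notin> A"
  shows "inj_on s2_proj A"
  unfolding vec.linear_inj_on_iff_eq_0[OF linear_s2_proj assms(1)]
proof (intro ballI impI)
  fix x assume x: "x \<in> A" "s2_proj x = 0"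
  show "x = 0"
  proof (rule ccontr)
    assume "x \<noteq> 0"
    with x(2) have "x$2 \<noteq> 0" and "s2e2 = (1 / x$2) *s x"
      by (auto simp: vec3_eq_iff)
    with x(1) assms show False
      by (metis vec.subspace_scale)
  qed
qed

lemma s2_proj_image:
  assumes "vec.subspace A" and "vec.dim A = 2" and "s2e2 \<notin> A"
  shows "s2_proj ` A = vec.span {s2e1, s2e3}"
proof (rule vec.subspace_dim_equal)
  show "vec.subspace (s2_proj ` A)"
    using vec.linear_subspace_image[OF linear_s2_proj assms(1)] .
  show "s2_proj ` A \<subseteq> vec.span {s2e1, s2e3}"
  proof
    fix y assume "y \<in> s2_proj ` A"
    then obtain x where "y = s2_proj x" by blast
    then have "y = x$1 *s s2e1 + x$3 *s s2e3" by (simp add: vec3_eq_iff)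
    then show "y \<in> vec.span {s2e1, s2e3}" by (auto simp: mem_span_pair_iff)
  qed
  have "inj_on s2_proj (vec.span A)"
    using assms(1,3) by (simp add: vec.span_eq_iff[THEN iffD2] inj_on_s2_proj)
  then have "vec.dim (s2_proj ` A) = vec.dim A"
    by (rule vec.dim_image_eq[OF linear_s2_proj])
  moreover have "vec.dim {s2e1, s2e3} = 2"
    by (rule dim_pair) (auto simp: vec.span_singleton vec3_eq_iff)
  ultimately show "vec.dim (vec.span {s2e1, s2e3}) \<le> vec.dim (s2_proj ` A)"
    using assms(2) by simp
qed simp

lemma s2_subalgebra_without_e2:
  assumes sub: "s2_subalgebra A" and dim: "vec.dim A = 2" and e2: "s2e2 \<notin> A"
  shows "\<exists>\<alpha>. A = vec.span {s2e1, \<alpha> *s s2e2 + s2e3}"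
proof -
  have A: "vec.subspace A" "\<And>x y. x \<in> A \<Longrightarrow> y \<in> A \<Longrightarrow> s2mult x y \<in> A"
    using sub by (auto simp: s2_subalgebra_def)
  have "s2e1 \<in> s2_proj ` A" "s2e3 \<in> s2_proj ` A"
    using s2_proj_image[OF A(1) dim e2] by (simp_all add: vec.span_base)
  then obtain u v where u: "u \<in> A" "s2_proj u = s2e1" and v: "v \<in> A" "s2_proj v = s2e3"
    by (metis imageE)
  have "s2_proj (s2mult u u) = s2_proj u"
    using u(2) by (simp add: s2_proj_s2mult vec3_eq_iff)
  then have "s2mult u u = u"
    using A(2)[OF u(1) u(1)] u(1) by (rule inj_onD[OF inj_on_s2_proj[OF A(1) e2]])
  then have "u = s2e1"
    using u(2) by (auto simp: vec3_eq_iff)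
  moreover have "A = vec.span {u, v}"
    by (rule subspace_eq_span_pair[OF A(1) dim u(1) v(1)])
      (use u(2) v(2) in \<open>auto simp: vec.span_singleton vec3_eq_iff\<close>)
  moreover have "v = v$2 *s s2e2 + s2e3"
    using v(2) by (auto simp: vec3_eq_iff)
  ultimately show ?thesis by metis
qed

lemma s2_collinear_square_cases:
  assumes x2: "x$2 = 0" and "x \<noteq> 0" and sq: "s2mult x x = a *s x"
  shows "\<exists>c w. c \<noteq> 0 \<and> w \<in> {s2e1, s2e1 + s2e3, s2e1 - s2e3} \<and> x = c *s w"
proof -
  have E1: "x$1 * x$1 + x$3 * x$3 = a * x$1" and E3: "2 * x$1 * x$3 = a * x$3"
    using arg_cong[OF sq, of "\<lambda>y. y$1"] arg_cong[OF sq, of "\<lambda>y. y$3"] by simp_all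
  show ?thesis
  proof (cases "x$3 = 0")
    case True
    with x2 \<open>x \<noteq> 0\<close> have "x$1 \<noteq> 0" and "x = x$1 *s s2e1"
      by (auto simp: vec3_eq_iff)
    then show ?thesis by blast
  next
    case False
    with E3 have "a = 2 * x$1" by simp
    with E1 have "(x$3 - x$1) * (x$3 + x$1) = 0" by (simp add: algebra_simps)
    then have "x$3 = x$1 \<or> x$3 = - x$1" by (simp add: eq_neg_iff_add_eq_0)
    with False x2 have "x$1 \<noteq> 0" and "x = x$1 *s (s2e1 + s2e3) \<or> x = x$1 *s (s2e1 - s2e3)"
      by (auto simp: vec3_eq_iff)
    then show ?thesis by blast
  qed
qed

lemma s2_subalgebra_with_e2:
  assumes sub: "s2_subalgebra A" and dim: "vec.dim A = 2" and e2: "s2e2 \<in> A"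
  shows "A = vec.span {s2e1, s2e2} \<or> A = vec.span {s2e1 + s2e3, s2e2} \<or>
    A = vec.span {s2e1 - s2e3, s2e2}"
proof -
  have A: "vec.subspace A" "\<And>x y. x \<in> A \<Longrightarrow> y \<in> A \<Longrightarrow> s2mult x y \<in> A"
    using sub by (auto simp: s2_subalgebra_def)
  have "\<not> A \<subseteq> vec.span {s2e2}"
    using vec.dim_subset[of A "vec.span {s2e2}"] dim by (auto split: if_splits)
  then obtain y where y: "y \<in> A" "y \<notin> vec.span {s2e2}" by blast
  define x where "x = s2_proj y"
  have "x \<in> A"
    unfolding x_def s2_proj_def using A(1) y(1) e2 by (simp add: vec.subspace_diff vec.subspace_scale)
  have x2: "x$2 = 0" by (simp add: x_def)
  have "x \<noteq> 0"
  proof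
    assume "x = 0"
    then have "y = y$2 *s s2e2" by (simp add: x_def s2_proj_def)
    with y(2) show False by (metis vec.span_base vec.span_scale singletonI)
  qed
  have A_eq: "A = vec.span {x, s2e2}"
    by (rule subspace_eq_span_pair[OF A(1) dim \<open>x \<in> A\<close> e2 \<open>x \<noteq> 0\<close>])
      (rule s2e2_notin_span_singleton[OF x2])
  obtain a b where sq: "s2mult x x = a *s x + b *s s2e2"
    using A(2)[OF \<open>x \<in> A\<close> \<open>x \<in> A\<close>] unfolding A_eq mem_span_pair_iff by blast
  have "b = 0"
    using arg_cong[OF sq, of "\<lambda>y. y$2"] x2 by simp
  with sq have "s2mult x x = a *s x" by simp
  then obtain c w where "c \<noteq> 0" and w: "w \<in> {s2e1, s2e1 + s2e3, s2e1 - s2e3}" and "x = c *s w"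
    using s2_collinear_square_cases[OF x2 \<open>x \<noteq> 0\<close>] by blast
  then have "w = (1 / c) *s x" by simp
  then have "w \<in> A" using A(1) \<open>x \<in> A\<close> by (simp add: vec.subspace_scale)
  have "A = vec.span {w, s2e2}"
    by (rule subspace_eq_span_pair[OF A(1) dim \<open>w \<in> A\<close> e2])
      (use w in \<open>auto simp: vec3_eq_iff intro!: s2e2_notin_span_singleton\<close>)
  with w show ?thesis by blast
qed

lemma s2_subalgebra_dim2_cases:
  assumes "s2_subalgebra A" and "vec.dim A = 2"
  shows "A = vec.span {s2e1, s2e2} \<or> A = vec.span {s2e1 + s2e3, s2e2} \<or>
    A = vec.span {s2e1 - s2e3, s2e2} \<or> (\<exists>\<alpha>. A = vec.span {s2e1, \<alpha> *s s2e2 + s2e3})"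
  using assms s2_subalgebra_with_e2 s2_subalgebra_without_e2 by blast

lemma s2_subalgebra_span_iff:
  "s2_subalgebra (vec.span S) \<longleftrightarrow> (\<forall>x\<in>vec.span S. \<forall>y\<in>vec.span S. s2mult x y \<in> vec.span S)"
  by (simp add: s2_subalgebra_def)

lemma mem_span_s2e1_s2e2: "x \<in> vec.span {s2e1, s2e2} \<longleftrightarrow> x$3 = 0"
  by (auto simp: mem_span_pair_iff vec3_eq_iff)

lemma mem_span_s2e1_plus_s2e3_s2e2: "x \<in> vec.span {s2e1 + s2e3, s2e2} \<longleftrightarrow> x$3 = x$1"
  by (auto simp: mem_span_pair_iff vec3_eq_iff)

lemma mem_span_s2e1_minus_s2e3_s2e2: "x \<in> vec.span {s2e1 - s2e3, s2e2} \<longleftrightarrow> x$3 = - x$1"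
  by (auto simp: mem_span_pair_iff vec3_eq_iff)

lemma mem_span_s2e1_shifted_s2e3: "x \<in> vec.span {s2e1, \<alpha> *s s2e2 + s2e3} \<longleftrightarrow> x$2 = \<alpha> * x$3"
  by (auto simp: mem_span_pair_iff vec3_eq_iff)

lemma s2_subalgebra_dim2_iff:
  "s2_subalgebra A \<and> vec.dim A = 2 \<longleftrightarrow>
    A = vec.span {s2e1, s2e2} \<or> A = vec.span {s2e1 + s2e3, s2e2} \<or>
    A = vec.span {s2e1 - s2e3, s2e2} \<or> (\<exists>\<alpha>. A = vec.span {s2e1, \<alpha> *s s2e2 + s2e3})"
    (is "_ \<longleftrightarrow> ?listed")
proof
  have pairs: "vec.dim {s2e1, s2e2} = 2" "vec.dim {s2e1 + s2e3, s2e2} = 2"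
    "vec.dim {s2e1 - s2e3, s2e2} = 2" "vec.dim {s2e1, \<alpha> *s s2e2 + s2e3} = 2" for \<alpha>
    by (rule dim_pair; auto simp: vec.span_singleton vec3_eq_iff)+
  assume ?listed
  then show "s2_subalgebra A \<and> vec.dim A = 2"
    by (elim disjE exE) (simp_all add: pairs s2_subalgebra_span_iff mem_span_s2e1_s2e2
        mem_span_s2e1_plus_s2e3_s2e2 mem_span_s2e1_minus_s2e3_s2e2 mem_span_s2e1_shifted_s2e3
        ring_distribs)
qed (use s2_subalgebra_dim2_cases in blast)

definition s2_shear :: "complex \<Rightarrow> complex^3 \<Rightarrow> complex^3" where
  "s2_shear \<beta> x = x + (\<beta> * x$3) *s s2e2"

lemma s2_shear_nth [simp]:
  "s2_shear \<beta> x $ 1 = x$1" "s2_shear \<beta> x $ 2 = x$2 + \<beta> * x$3" "s2_shear \<beta> x $ 3 = x$3"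
  by (simp_all add: s2_shear_def)

lemma linear_s2_shear: "Vector_Spaces.linear (*s) (*s) (s2_shear \<beta>)"
  by unfold_locales (simp_all add: vec3_eq_iff algebra_simps)

lemma s2_automorphism_shear: "s2_automorphism (s2_shear \<beta>)"
  unfolding s2_automorphism_def
proof (intro conjI allI linear_s2_shear)
  show "bij (s2_shear \<beta>)"
    by (rule o_bij[of "s2_shear (- \<beta>)"]) (simp_all add: fun_eq_iff vec3_eq_iff)
  show "s2_shear \<beta> (s2mult x y) = s2mult (s2_shear \<beta> x) (s2_shear \<beta> y)" for x y
    by (simp add: vec3_eq_iff algebra_simps)
qed

lemma s2_shear_image_span:
  "s2_shear (- \<alpha>) ` vec.span {s2e1, \<alpha> *s s2e2 + s2e3} = vec.span {s2e1, s2e3}"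
proof -
  have "s2_shear (- \<alpha>) s2e1 = s2e1" "s2_shear (- \<alpha>) (\<alpha> *s s2e2 + s2e3) = s2e3"
    by (simp_all add: vec3_eq_iff)
  then show ?thesis
    by (simp flip: vec.linear_span_image[OF linear_s2_shear])
qed

lemma s2_subalgebra_dim2_equivalent:
  assumes "s2_subalgebra A" and "vec.dim A = 2"
  obtains f where "s2_automorphism f"
    and "f ` A = vec.span {s2e1, s2e2} \<or> f ` A = vec.span {s2e1 + s2e3, s2e2} \<or>
      f ` A = vec.span {s2e1 - s2e3, s2e2} \<or> f ` A = vec.span {s2e1, s2e3}"
proof -
  consider "A = vec.span {s2e1, s2e2} \<or> A = vec.span {s2e1 + s2e3, s2e2} \<or>
      A = vec.span {s2e1 - s2e3, s2e2}"
    | \<alpha> where "A = vec.span {s2e1, \<alpha> *s s2e2 + s2e3}"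
    using s2_subalgebra_dim2_cases[OF assms] by blast
  then show ?thesis
  proof cases
    case 1
    moreover have "s2_automorphism id"
      by (simp add: s2_automorphism_def vec.linear_id)
    ultimately show ?thesis
      using that by (metis id_apply image_id)
  next
    case 2
    then show ?thesis
      using that s2_automorphism_shear s2_shear_image_span by blast
  qed
qed

theorem mainTheorem17:
  shows "(\<forall>A. (s2_subalgebra A \<and> vec.dim A = 2) \<longleftrightarrow>
            (A = vec.span {s2e1, s2e2} \<or>
             A = vec.span {s2e1 + s2e3, s2e2} \<or>
             A = vec.span {s2e1 - s2e3, s2e2} \<or>
             (\<exists>\<alpha>::complex. A = vec.span {s2e1, \<alpha> *s s2e2 + s2e3})))
       \<and> (\<forall>A. s2_subalgebra A \<and> vec.dim A = 2 \<longrightarrow>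
            (\<exists>f. s2_automorphism f \<and>
               (f ` A = vec.span {s2e1, s2e2} \<or>
                f ` A = vec.span {s2e1 + s2e3, s2e2} \<or>
                f ` A = vec.span {s2e1 - s2e3, s2e2} \<or>
                f ` A = vec.span {s2e1, s2e3})))"
  by (intro conjI allI impI s2_subalgebra_dim2_iff) (metis s2_subalgebra_dim2_equivalent)

end
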